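(* Let $f,g:\mathbb{R}^m\times\mathbb{R}^n\to\mathbb{R}$ be twice differentiable at a point $(x_k,y_k)\in\mathbb{R}^m\times\mathbb{R}^n$, let $\eta>0$, and let all derivatives of $f$ and $g$ below be evaluated at $(x_k,y_k)$. Consider the two-player game in which player 1 chooses $x\in\mathbb{R}^m$, player 2 chooses $y\in\mathbb{R}^n$, and their respective objectives are $$\min_{x\in\mathbb{R}^m}\; x^{\top}\nabla_x f + x^{\top}D_{xy}^2 f\, y + y^{\top}\nabla_y f + \frac{1}{2\eta}x^{\top}x,$$ $$\min_{y\in\mathbb{R}^n}\; y^{\top}\nabla_y g + y^{\top}D_{yx}^2 g\, x + x^{\top}\nabla_x g + \frac{1}{2\eta}y^{\top}y.$$ Assume that the matrices $\operatorname{Id}-\eta^2 D_{xy}^2 f\,D_{yx}^2 g$ and $\operatorname{Id}-\eta^2 D_{yx}^2 g\,D_{xy}^2 f$ are invertible. Then, among all (possibly randomized) strategies with finite first moment, the only Nash equilibrium of this game is the deterministic pair $$x=-\eta\left(\operatorname{Id}-\eta^2 D_{xy}^2 f\,D_{yx}^2 g\right)^{-1}\left(\nabla_x f-\eta D_{xy}^2 f\,\nabla_y g\right),$$ $$y=-\eta\left(\operatorname{Id}-\eta^2 D_{yx}^2 g\,D_{xy}^2 f\right)^{-1}\left(\nabla_y g-\eta D_{yx}^2 g\,\nabla_x f\right).$$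
   Context: $\nabla_x f\in\mathbb{R}^m$ and $\nabla_y g\in\mathbb{R}^n$ denote partial gradients. $D_{xy}^2 f$ is the $m\times n$ matrix with entries $\partial^2 f/\partial x_i\partial y_j$, and $D_{yx}^2 g$ is the $n\times m$ matrix with entries $\partial^2 g/\partial y_i\partial x_j$. A randomized strategy of player 1 (resp. player 2) is a random vector $X$ in $\mathbb{R}^m$ (resp. $Y$ in $\mathbb{R}^n$); the two players randomize independently of each other, and each player minimizes the expectation of their own objective. A Nash equilibrium is a pair of strategies such that no player can decrease their (expected) objective by unilaterally changing their own strategy. Deterministic strategies are the special case of almost surely constant random vectors. *)

theory Defs
  imports "HOL-Probability.Probability"
begin

text \<open>Derivatives of functions on \<open>\<real>\<^sup>m \<times> \<real>\<^sup>n\<close>.\<close>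

definition twice_differentiable_at ::
  "('a::real_normed_vector \<Rightarrow> 'b::real_normed_vector) \<Rightarrow> 'a \<Rightarrow> bool" where
  "twice_differentiable_at f p \<longleftrightarrow>
     (\<exists>f' :: 'a \<Rightarrow> 'a \<Rightarrow>\<^sub>L 'b.
        (\<forall>\<^sub>F z in nhds p. (f has_derivative blinfun_apply (f' z)) (at z)) \<and>
        f' differentiable (at p))"

definition partial_x ::
  "'m \<Rightarrow> ((real^'m) \<times> (real^'n) \<Rightarrow> real) \<Rightarrow> (real^'m) \<times> (real^'n) \<Rightarrow> real" where
  "partial_x i f = (\<lambda>(x, y). deriv (\<lambda>t. f (x + t *\<^sub>R axis i 1, y)) 0)"

definition partial_y ::
  "'n \<Rightarrow> ((real^'m) \<times> (real^'n) \<Rightarrow> real) \<Rightarrow> (real^'m) \<times> (real^'n) \<Rightarrow> real" where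
  "partial_y j f = (\<lambda>(x, y). deriv (\<lambda>t. f (x, y + t *\<^sub>R axis j 1)) 0)"

definition grad_x :: "((real^'m) \<times> (real^'n) \<Rightarrow> real) \<Rightarrow> (real^'m) \<times> (real^'n) \<Rightarrow> real^'m" where
  "grad_x f p = (\<chi> i. partial_x i f p)"

definition grad_y :: "((real^'m) \<times> (real^'n) \<Rightarrow> real) \<Rightarrow> (real^'m) \<times> (real^'n) \<Rightarrow> real^'n" where
  "grad_y f p = (\<chi> j. partial_y j f p)"

definition D2xy :: "((real^'m) \<times> (real^'n) \<Rightarrow> real) \<Rightarrow> (real^'m) \<times> (real^'n) \<Rightarrow> real^'n^'m" where
  "D2xy f p = (\<chi> i j. partial_x i (partial_y j f) p)"

definition D2yx :: "((real^'m) \<times> (real^'n) \<Rightarrow> real) \<Rightarrow> (real^'m) \<times> (real^'n) \<Rightarrow> real^'m^'n" where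
  "D2yx g p = (\<chi> i j. partial_y i (partial_x j g) p)"

text \<open>The objectives of the two players in the regularized bilinear local game at \<open>p\<close>.\<close>

definition objective1 ::
  "((real^'m) \<times> (real^'n) \<Rightarrow> real) \<Rightarrow> (real^'m) \<times> (real^'n) \<Rightarrow> real \<Rightarrow> (real^'m) \<times> (real^'n) \<Rightarrow> real" where
  "objective1 f p \<eta> = (\<lambda>(x, y).
     x \<bullet> grad_x f p + x \<bullet> (D2xy f p *v y) + y \<bullet> grad_y f p + 1 / (2 * \<eta>) * (x \<bullet> x))"

definition objective2 ::
  "((real^'m) \<times> (real^'n) \<Rightarrow> real) \<Rightarrow> (real^'m) \<times> (real^'n) \<Rightarrow> real \<Rightarrow> (real^'m) \<times> (real^'n) \<Rightarrow> real" where
  "objective2 g p \<eta> = (\<lambda>(x, y).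
     y \<bullet> grad_y g p + y \<bullet> (D2yx g p *v x) + x \<bullet> grad_x g p + 1 / (2 * \<eta>) * (y \<bullet> y))"

text \<open>
  A randomized strategy is given by the law of the random vector. Since the players randomize
  independently, the joint law of a pair of strategies is the product measure. The strategy that
  is almost surely equal to \<open>x\<close> is \<open>return borel x\<close>.
\<close>

definition strategy :: "'a::euclidean_space measure \<Rightarrow> bool" where
  "strategy \<mu> \<longleftrightarrow> prob_space \<mu> \<and> sets \<mu> = sets borel \<and> integrable \<mu> (\<lambda>x. norm x)"

text \<open>
  The expectation takes values in the extended reals, as the quadratic term of an objective has
  expectation \<open>\<infinity>\<close> when the second moment is infinite; the Bochner integral would
  be \<open>0\<close> there. The case \<open>\<infinity> - \<infinity>\<close> does not arise for the objectives
  above: under finite first moments and independence their negative parts are integrable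
  if \<open>\<eta> > 0\<close>.
\<close>

definition ext_expectation :: "'a measure \<Rightarrow> ('a \<Rightarrow> real) \<Rightarrow> ereal" where
  "ext_expectation M h =
     enn2ereal (\<integral>\<^sup>+ z. ennreal (h z) \<partial>M) - enn2ereal (\<integral>\<^sup>+ z. ennreal (- h z) \<partial>M)"

definition nash_equilibrium ::
  "('a::euclidean_space \<times> 'b::euclidean_space \<Rightarrow> real) \<Rightarrow> ('a \<times> 'b \<Rightarrow> real) \<Rightarrow>
   'a measure \<Rightarrow> 'b measure \<Rightarrow> bool" where
  "nash_equilibrium J\<^sub>1 J\<^sub>2 \<mu> \<nu> \<longleftrightarrow>
     strategy \<mu> \<and> strategy \<nu> \<and>
     (\<forall>\<mu>'. strategy \<mu>' \<longrightarrow>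
        ext_expectation (\<mu> \<Otimes>\<^sub>M \<nu>) J\<^sub>1 \<le> ext_expectation (\<mu>' \<Otimes>\<^sub>M \<nu>) J\<^sub>1) \<and>
     (\<forall>\<nu>'. strategy \<nu>' \<longrightarrow>
        ext_expectation (\<mu> \<Otimes>\<^sub>M \<nu>) J\<^sub>2 \<le> ext_expectation (\<mu> \<Otimes>\<^sub>M \<nu>') J\<^sub>2)"

end

theory Submission imports Defs begin

text \<open>
  Against a fixed strategy of the opponent, the objective of a player is a strictly convex
  quadratic in the own variable, and it is affine in the variable of the opponent. By
  independence, the opponent therefore enters only through a mean. If \<open>y\<close> has mean
  \<open>m\<close>, completing the square around \<open>b = - \<eta> (a + A m)\<close> turns the expected
  objective of player 1 into the expectation of \<open>\<parallel>x - b\<parallel>\<^sup>2 / (2 \<eta>)\<close> plus a finite term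
  on which player 1 has no influence (\<open>ext_expectation_completed_square\<close>). The first term
  is nonnegative, possibly infinite, and zero exactly for the point mass at \<open>b\<close>. So the
  point mass at \<open>b\<close> is the only best response, also among randomized strategies
  (\<open>best_response_iff\<close>); for player 2 the same holds after exchanging the factors of the
  product measure.

  Hence an equilibrium consists of two point masses, located at points \<open>x\<close> and
  \<open>y\<close> that satisfy \<open>x = - \<eta> (a + A y)\<close> and \<open>y = - \<eta> (b + B x)\<close>, where
  now \<open>a\<close> and \<open>b\<close> are the gradients and \<open>A\<close> and \<open>B\<close> the mixed
  second derivatives in the two objectives. Substituting one equation into the other gives
  a linear system for each point, and the invertibility assumptions make its solution unique
  (\<open>best_response_fixed_point_iff\<close>).
\<close>

section \<open>Extended expectations\<close>

text \<open>
  The rule isolates the only source of an infinite value: the negative part of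
  \<open>q + l\<close> is dominated by that of \<open>l\<close>, so it has a finite integral. The identity then
  is the integral of a pointwise balance of positive and negative parts, in which every term
  but the positive part of \<open>q + l\<close> and \<open>q\<close> itself is finite and can be moved freely.
\<close>

lemma ext_expectation_nonneg_plus_integrable:
  fixes q l :: "'a \<Rightarrow> real"
  assumes q: "q \<in> borel_measurable M" "\<And>z. 0 \<le> q z" and l: "integrable M l"
  shows "ext_expectation M (\<lambda>z. q z + l z) =
    enn2ereal (\<integral>\<^sup>+ z. ennreal (q z) \<partial>M) + ereal (\<integral>z. l z \<partial>M)"
proof -
  define P N Q Lp Ln where
    "P = (\<integral>\<^sup>+ z. ennreal (q z + l z) \<partial>M)" and
    "N = (\<integral>\<^sup>+ z. ennreal (- (q z + l z)) \<partial>M)" and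
    "Q = (\<integral>\<^sup>+ z. ennreal (q z) \<partial>M)" and
    "Lp = (\<integral>\<^sup>+ z. ennreal (l z) \<partial>M)" and
    "Ln = (\<integral>\<^sup>+ z. ennreal (- l z) \<partial>M)"
  have [measurable]: "q \<in> borel_measurable M" "l \<in> borel_measurable M"
    using q l by auto
  have Lp: "Lp \<noteq> \<infinity>" and Ln: "Ln \<noteq> \<infinity>"
    using l unfolding Lp_def Ln_def real_integrable_def by auto
  have "N \<le> Ln"
    unfolding N_def Ln_def by (intro nn_integral_mono ennreal_leI) (use q(2) in auto)
  with Ln have N: "N \<noteq> \<infinity>"
    by (auto simp: top_unique)
  have pointwise: "ennreal (q z + l z) + ennreal (- l z) =
      ennreal (q z) + ennreal (l z) + ennreal (- (q z + l z))" for z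
  proof (cases "l z \<ge> 0")
    case True
    then show ?thesis using q(2)[of z] by (simp add: ennreal_neg)
  next
    case False
    then have "ennreal (q z) + ennreal (- (q z + l z)) = ennreal (q z + l z) + ennreal (- l z)"
      using q(2)[of z]
      by (cases "q z + l z \<ge> 0") (simp_all add: ennreal_neg flip: ennreal_plus)
    then show ?thesis using False by (simp add: ennreal_neg)
  qed
  have "P + Ln = (\<integral>\<^sup>+ z. ennreal (q z + l z) + ennreal (- l z) \<partial>M)"
    unfolding P_def Ln_def by (rule nn_integral_add[symmetric]) auto
  also have "\<dots> = (\<integral>\<^sup>+ z. ennreal (q z) + ennreal (l z) + ennreal (- (q z + l z)) \<partial>M)"
    by (simp only: pointwise)
  also have "\<dots> = Q + Lp + N"
    unfolding Q_def Lp_def N_def by (subst nn_integral_add; simp)+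
  finally have balance: "enn2ereal P + enn2ereal Ln = enn2ereal Q + enn2ereal Lp + enn2ereal N"
    by (metis plus_ennreal.rep_eq)
  have int: "(\<integral>z. l z \<partial>M) = enn2real Lp - enn2real Ln"
    using real_lebesgue_integral_def[OF l] by (simp add: Lp_def Ln_def)
  obtain r where r: "Lp = ennreal r" "r \<ge> 0" using Lp by (cases Lp) auto
  obtain s where s: "Ln = ennreal s" "s \<ge> 0" using Ln by (cases Ln) auto
  obtain t where t: "N = ennreal t" "t \<ge> 0" using N by (cases N) auto
  have "enn2ereal P - enn2ereal N = enn2ereal Q + ereal (enn2real Lp - enn2real Ln)"
    using balance r s t
    by (cases "enn2ereal P"; cases "enn2ereal Q") (auto simp: enn2ereal_ennreal)
  then show ?thesis
    unfolding ext_expectation_def P_def N_def Q_def int .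
qed

section \<open>Best responses\<close>

lemma strategy_return: "strategy (return borel (x :: 'a::euclidean_space))"
proof -
  have "integrable (return borel x) (\<lambda>z. norm z)"
    by (rule integrableI_bounded) (auto simp: nn_integral_return)
  then show ?thesis
    by (simp add: strategy_def prob_space_return)
qed

lemma strategy_integrable_ident:
  assumes "strategy \<mu>" shows "integrable \<mu> (\<lambda>x. x)"
proof -
  have [measurable_cong]: "sets \<mu> = sets borel" using assms by (simp add: strategy_def)
  have "(\<lambda>x. x) \<in> borel_measurable \<mu>" by measurable
  then show ?thesis
    using assms integrable_norm_iff[of "\<lambda>x. x" \<mu>] by (simp add: strategy_def)
qed

text \<open>
  The coefficient of \<open>x\<close> that remains after completing the square is
  \<open>A y - A m\<close>, where \<open>m\<close> is the mean of \<open>y\<close>. Its expectation given \<open>x\<close>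
  vanishes, and the product of \<open>x\<close> with it is integrable because the
  factors are independent with finite first moments. Only the square can have infinite
  expectation, which is how the formula covers strategies of infinite variance.
\<close>

lemma ext_expectation_completed_square:
  fixes \<mu> :: "'a::euclidean_space measure" and \<nu> :: "'b::euclidean_space measure"
    and A :: "'b \<Rightarrow> 'a" and a :: 'a and c :: 'b and \<eta> :: real
  assumes \<mu>: "strategy \<mu>" and \<nu>: "strategy \<nu>" and A: "bounded_linear A" and \<eta>: "\<eta> > 0"
  defines "b \<equiv> - \<eta> *\<^sub>R (a + A (\<integral>y. y \<partial>\<nu>))"
  shows "ext_expectation (\<mu> \<Otimes>\<^sub>M \<nu>)
      (\<lambda>(x, y). x \<bullet> a + x \<bullet> A y + y \<bullet> c + 1 / (2 * \<eta>) * (x \<bullet> x)) =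
    enn2ereal (\<integral>\<^sup>+ x. ennreal (1 / (2 * \<eta>) * (norm (x - b))\<^sup>2) \<partial>\<mu>) +
    ereal ((\<integral>y. y \<partial>\<nu>) \<bullet> c - 1 / (2 * \<eta>) * (b \<bullet> b))"
proof -
  interpret \<mu>: prob_space \<mu> using \<mu> by (simp add: strategy_def)
  interpret \<nu>: prob_space \<nu> using \<nu> by (simp add: strategy_def)
  interpret pair_prob_space \<mu> \<nu> ..
  interpret A: bounded_linear A by (rule A)
  have [measurable_cong]: "sets \<mu> = sets borel" "sets \<nu> = sets borel"
    using \<mu> \<nu> by (simp_all add: strategy_def)
  have [measurable]: "A \<in> borel_measurable borel"
    by (intro borel_measurable_continuous_onI A.continuous_on continuous_on_id)
  note i\<mu> = strategy_integrable_ident[OF \<mu>] and i\<nu> = strategy_integrable_ident[OF \<nu>]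
  have iA: "integrable \<nu> (\<lambda>y. A y)"
    by (rule integrable_bounded_linear[OF A i\<nu>])
  have A_mean: "(\<integral>y. A y \<partial>\<nu>) = A (\<integral>y. y \<partial>\<nu>)"
    by (rule integral_bounded_linear[OF A i\<nu>])
  \<comment> \<open>the square, of possibly infinite expectation, and the integrable rest\<close>
  define q :: "'a \<times> 'b \<Rightarrow> real" where "q = (\<lambda>(x, y). 1 / (2 * \<eta>) * (norm (x - b))\<^sup>2)"
  define l :: "'a \<times> 'b \<Rightarrow> real" where
    "l = (\<lambda>(x, y). x \<bullet> (a + (1 / \<eta>) *\<^sub>R b + A y) + (y \<bullet> c - 1 / (2 * \<eta>) * (b \<bullet> b)))"
  have split: "(case z of (x, y) \<Rightarrow> x \<bullet> a + x \<bullet> A y + y \<bullet> c + 1 / (2 * \<eta>) * (x \<bullet> x)) = q z + l z" for z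
    unfolding q_def l_def using \<eta>
    by (cases z) (simp add: power2_norm_eq_inner inner_diff inner_add_right inner_commute field_simps)
  have [measurable]: "q \<in> borel_measurable (\<mu> \<Otimes>\<^sub>M \<nu>)" "l \<in> borel_measurable (\<mu> \<Otimes>\<^sub>M \<nu>)"
    unfolding q_def l_def by measurable
  have fst: "integrable \<nu> (\<lambda>y. l (x, y))" for x
    unfolding l_def using i\<nu> iA by auto
  have fst_mean: "(\<integral>y. l (x, y) \<partial>\<nu>) = (\<integral>y. y \<partial>\<nu>) \<bullet> c - 1 / (2 * \<eta>) * (b \<bullet> b)" for x
  proof -
    have "(\<integral>y. l (x, y) \<partial>\<nu>) = x \<bullet> (a + (1 / \<eta>) *\<^sub>R b + A (\<integral>y. y \<partial>\<nu>))
        + ((\<integral>y. y \<partial>\<nu>) \<bullet> c - 1 / (2 * \<eta>) * (b \<bullet> b))"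
      unfolding l_def using i\<nu> iA by (simp add: inner_add_right \<nu>.prob_space A_mean)
    also have "a + (1 / \<eta>) *\<^sub>R b + A (\<integral>y. y \<partial>\<nu>) = 0"
      unfolding b_def using \<eta> by (simp add: algebra_simps)
    finally show ?thesis by simp
  qed
  define K where "K = (\<integral>y. norm (a + (1 / \<eta>) *\<^sub>R b + A y) \<partial>\<nu>)"
  define K' where "K' = (\<integral>y. norm (y \<bullet> c - 1 / (2 * \<eta>) * (b \<bullet> b)) \<partial>\<nu>)"
  have norm_le: "(\<integral>y. norm (l (x, y)) \<partial>\<nu>) \<le> norm x * K + K'" for x
  proof -
    have "(\<integral>y. norm (l (x, y)) \<partial>\<nu>) \<le>
      (\<integral>y. norm x * norm (a + (1 / \<eta>) *\<^sub>R b + A y) + norm (y \<bullet> c - 1 / (2 * \<eta>) * (b \<bullet> b)) \<partial>\<nu>)"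
    proof (rule integral_mono)
      show "integrable \<nu> (\<lambda>y. norm (l (x, y)))" using fst by (rule integrable_norm)
      show "integrable \<nu> (\<lambda>y. norm x * norm (a + (1 / \<eta>) *\<^sub>R b + A y)
          + norm (y \<bullet> c - 1 / (2 * \<eta>) * (b \<bullet> b)))"
        using i\<nu> iA by (intro Bochner_Integration.integrable_add integrable_mult_right integrable_norm) auto
      show "norm (l (x, y)) \<le> norm x * norm (a + (1 / \<eta>) *\<^sub>R b + A y)
          + norm (y \<bullet> c - 1 / (2 * \<eta>) * (b \<bullet> b))" for y
        unfolding l_def prod.case
        by (rule order_trans[OF norm_triangle_ineq]) (simp add: Cauchy_Schwarz_ineq2)
    qed
    also have "\<dots> = norm x * K + K'"
      unfolding K_def K'_def using i\<nu> iA
      by (subst Bochner_Integration.integral_add) auto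
    finally show ?thesis .
  qed
  have l: "integrable (\<mu> \<Otimes>\<^sub>M \<nu>) l"
  proof (rule Fubini_integrable)
    show "integrable \<mu> (\<lambda>x. \<integral>y. norm (l (x, y)) \<partial>\<nu>)"
    proof (rule Bochner_Integration.integrable_bound)
      show "integrable \<mu> (\<lambda>x. norm x * K + K')" using i\<mu> by auto
      show "AE x in \<mu>. norm (\<integral>y. norm (l (x, y)) \<partial>\<nu>) \<le> norm (norm x * K + K')"
      proof (rule AE_I2)
        fix x
        have "0 \<le> (\<integral>y. norm (l (x, y)) \<partial>\<nu>)" by simp
        with norm_le[of x]
        show "norm (\<integral>y. norm (l (x, y)) \<partial>\<nu>) \<le> norm (norm x * K + K')" by simp
      qed
    qed measurable
  qed (use fst in auto)
  have int_l: "(\<integral>z. l z \<partial>(\<mu> \<Otimes>\<^sub>M \<nu>)) = (\<integral>y. y \<partial>\<nu>) \<bullet> c - 1 / (2 * \<eta>) * (b \<bullet> b)"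
    using integral_fst'[OF l] by (simp add: fst_mean \<mu>.prob_space)
  have int_q: "(\<integral>\<^sup>+ z. ennreal (q z) \<partial>(\<mu> \<Otimes>\<^sub>M \<nu>)) =
      (\<integral>\<^sup>+ x. ennreal (1 / (2 * \<eta>) * (norm (x - b))\<^sup>2) \<partial>\<mu>)"
    by (subst \<nu>.nn_integral_fst[symmetric]) (auto simp: q_def \<nu>.emeasure_space_1)
  show ?thesis
    unfolding split
    by (subst ext_expectation_nonneg_plus_integrable[OF _ _ l])
       (use \<eta> in \<open>auto simp: int_l int_q\<close>, auto simp: q_def)
qed

lemma mean_square_deviation_eq_0_iff:
  fixes \<mu> :: "'a::euclidean_space measure"
  assumes \<mu>: "strategy \<mu>" and \<eta>: "\<eta> > 0"
  shows "(\<integral>\<^sup>+ x. ennreal (1 / (2 * \<eta>) * (norm (x - b))\<^sup>2) \<partial>\<mu>) = 0 \<longleftrightarrow> \<mu> = return borel b"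
proof
  interpret \<mu>: prob_space \<mu> using \<mu> by (simp add: strategy_def)
  have sets_\<mu>[measurable_cong]: "sets \<mu> = sets borel" using \<mu> by (simp add: strategy_def)
  assume "(\<integral>\<^sup>+ x. ennreal (1 / (2 * \<eta>) * (norm (x - b))\<^sup>2) \<partial>\<mu>) = 0"
  then have "AE x in \<mu>. ennreal (1 / (2 * \<eta>) * (norm (x - b))\<^sup>2) = 0"
    by (subst (asm) nn_integral_0_iff_AE) auto
  then have AE: "AE x in \<mu>. x = b"
    using \<eta> by (auto simp: ennreal_eq_0_iff divide_le_0_iff zero_less_mult_iff elim!: eventually_mono)
  show "\<mu> = return borel b"
  proof (rule measure_eqI)
    fix X assume X: "X \<in> sets \<mu>"
    have "emeasure \<mu> X = (\<integral>\<^sup>+ x. indicator X x \<partial>\<mu>)" using X by simp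
    also have "\<dots> = (\<integral>\<^sup>+ x. indicator X b \<partial>\<mu>)"
      by (rule nn_integral_cong_AE) (use AE in auto)
    also have "\<dots> = indicator X b" by (simp add: \<mu>.emeasure_space_1)
    finally show "emeasure \<mu> X = emeasure (return borel b) X" using X sets_\<mu> by simp
  qed (use sets_\<mu> in simp)
next
  assume "\<mu> = return borel b"
  then show "(\<integral>\<^sup>+ x. ennreal (1 / (2 * \<eta>) * (norm (x - b))\<^sup>2) \<partial>\<mu>) = 0"
    by (simp add: nn_integral_return)
qed

text \<open>
  The expected objectives of two strategies differ only in the mean square deviation from the
  same point, and the point mass there attains the value 0.
\<close>

lemma best_response_iff:
  fixes \<mu> :: "'a::euclidean_space measure" and \<nu> :: "'b::euclidean_space measure"
    and A :: "'b \<Rightarrow> 'a" and a :: 'a and c :: 'b and \<eta> :: real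
  assumes \<mu>: "strategy \<mu>" and \<nu>: "strategy \<nu>" and A: "bounded_linear A" and \<eta>: "\<eta> > 0"
  defines "J \<equiv> \<lambda>(x, y). x \<bullet> a + x \<bullet> A y + y \<bullet> c + 1 / (2 * \<eta>) * (x \<bullet> x)"
  shows "(\<forall>\<mu>'. strategy \<mu>' \<longrightarrow>
      ext_expectation (\<mu> \<Otimes>\<^sub>M \<nu>) J \<le> ext_expectation (\<mu>' \<Otimes>\<^sub>M \<nu>) J) \<longleftrightarrow>
    \<mu> = return borel (- \<eta> *\<^sub>R (a + A (\<integral>y. y \<partial>\<nu>)))"
proof -
  define b where "b = - \<eta> *\<^sub>R (a + A (\<integral>y. y \<partial>\<nu>))"
  define V where "V = (\<lambda>\<mu>. \<integral>\<^sup>+ x. ennreal (1 / (2 * \<eta>) * (norm (x - b))\<^sup>2) \<partial>\<mu>)"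
  have E: "ext_expectation (\<mu>' \<Otimes>\<^sub>M \<nu>) J \<le> ext_expectation (\<mu>'' \<Otimes>\<^sub>M \<nu>) J \<longleftrightarrow> V \<mu>' \<le> V \<mu>''"
    if "strategy \<mu>'" "strategy \<mu>''" for \<mu>' \<mu>''
    unfolding J_def ext_expectation_completed_square[OF that(1) \<nu> A \<eta>]
      ext_expectation_completed_square[OF that(2) \<nu> A \<eta>]
    by (simp add: V_def b_def less_eq_ennreal.rep_eq ereal_add_le_add_iff2)
  have "(\<forall>\<mu>'. strategy \<mu>' \<longrightarrow> V \<mu> \<le> V \<mu>') \<longleftrightarrow> V \<mu> = 0"
  proof
    assume "\<forall>\<mu>'. strategy \<mu>' \<longrightarrow> V \<mu> \<le> V \<mu>'"
    then have "V \<mu> \<le> V (return borel b)" using strategy_return by blast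
    also have "V (return borel b) = 0"
      unfolding V_def by (subst mean_square_deviation_eq_0_iff[OF strategy_return \<eta>]) simp
    finally show "V \<mu> = 0" by simp
  qed simp
  then show ?thesis
    using E[OF \<mu>] mean_square_deviation_eq_0_iff[OF \<mu> \<eta>, of b] by (simp add: V_def b_def)
qed

text \<open>
  This carries what is shown for player 1, whose variable is the first component, over to
  player 2.
\<close>

lemma ext_expectation_swap:
  fixes J :: "'a::euclidean_space \<times> 'b::euclidean_space \<Rightarrow> real"
  assumes \<mu>: "strategy \<mu>" and \<nu>: "strategy \<nu>" and J: "J \<in> borel_measurable borel"
  shows "ext_expectation (\<mu> \<Otimes>\<^sub>M \<nu>) J = ext_expectation (\<nu> \<Otimes>\<^sub>M \<mu>) (\<lambda>(y, x). J (x, y))"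
proof -
  interpret \<mu>: prob_space \<mu> using \<mu> by (simp add: strategy_def)
  interpret \<nu>: prob_space \<nu> using \<nu> by (simp add: strategy_def)
  interpret pair_prob_space \<mu> \<nu> ..
  have [measurable_cong]: "sets \<mu> = sets borel" "sets \<nu> = sets borel"
    using \<mu> \<nu> by (simp_all add: strategy_def)
  have [measurable]: "J \<in> borel_measurable (borel \<Otimes>\<^sub>M borel)"
    using J by (simp add: borel_prod)
  have "(\<integral>\<^sup>+ z. h (J z) \<partial>(\<mu> \<Otimes>\<^sub>M \<nu>)) = (\<integral>\<^sup>+ z. h (case z of (y, x) \<Rightarrow> J (x, y)) \<partial>(\<nu> \<Otimes>\<^sub>M \<mu>))"
    if [measurable]: "h \<in> borel_measurable borel" for h :: "real \<Rightarrow> ennreal"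
  proof -
    have "(\<integral>\<^sup>+ z. h (J z) \<partial>(\<mu> \<Otimes>\<^sub>M \<nu>)) =
        (\<integral>\<^sup>+ z. h (J z) \<partial>distr (\<nu> \<Otimes>\<^sub>M \<mu>) (\<mu> \<Otimes>\<^sub>M \<nu>) (\<lambda>(x, y). (y, x)))"
      by (simp only: distr_pair_swap[symmetric])
    also have "\<dots> = (\<integral>\<^sup>+ z. h (J (case z of (x, y) \<Rightarrow> (y, x))) \<partial>(\<nu> \<Otimes>\<^sub>M \<mu>))"
      by (rule nn_integral_distr) measurable
    also have "\<dots> = (\<integral>\<^sup>+ z. h (case z of (y, x) \<Rightarrow> J (x, y)) \<partial>(\<nu> \<Otimes>\<^sub>M \<mu>))"
      by (simp only: case_prod_beta)
    finally show ?thesis .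
  qed
  from this[of ennreal] this[of "\<lambda>r. ennreal (- r)"] show ?thesis
    by (simp add: ext_expectation_def)
qed

section \<open>The fixed point of the best responses\<close>

lemma eq_matrix_inv_mult_vector_iff:
  fixes M :: "real^'n^'n"
  assumes "invertible M"
  shows "x = matrix_inv M *v v \<longleftrightarrow> M *v x = v"
proof -
  have "M ** matrix_inv M = mat 1 \<and> matrix_inv M ** M = mat 1"
    using assms unfolding invertible_def matrix_inv_def by (rule someI_ex)
  then show ?thesis
    by (metis matrix_vector_mul_assoc matrix_vector_mul_lid)
qed

text \<open>
  Inserting the second equation into the first gives
  \<open>(Id - \<eta>\<^sup>2 A B) x = - \<eta> (a - \<eta> A b)\<close>, and symmetrically for \<open>y\<close>. That the
  two separately computed solutions fit together needs uniqueness: if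
  \<open>x\<close> solves its equation, then \<open>- \<eta> (b + B x)\<close> solves the equation of
  \<open>y\<close>.
\<close>

lemma best_response_fixed_point_iff:
  fixes A :: "real^'n^'m" and B :: "real^'m^'n" and a :: "real^'m" and b :: "real^'n"
  assumes "invertible (mat 1 - \<eta>\<^sup>2 *\<^sub>R (A ** B))" "invertible (mat 1 - \<eta>\<^sup>2 *\<^sub>R (B ** A))"
  shows "x = - \<eta> *\<^sub>R (a + A *v y) \<and> y = - \<eta> *\<^sub>R (b + B *v x) \<longleftrightarrow>
    x = - \<eta> *\<^sub>R (matrix_inv (mat 1 - \<eta>\<^sup>2 *\<^sub>R (A ** B)) *v (a - \<eta> *\<^sub>R (A *v b))) \<and>
    y = - \<eta> *\<^sub>R (matrix_inv (mat 1 - \<eta>\<^sup>2 *\<^sub>R (B ** A)) *v (b - \<eta> *\<^sub>R (B *v a)))"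
proof -
  \<comment> \<open>stated for all matrices, so that it serves both players\<close>
  have elim: "x = - \<eta> *\<^sub>R (matrix_inv (mat 1 - \<eta>\<^sup>2 *\<^sub>R (A ** B)) *v (a - \<eta> *\<^sub>R (A *v b))) \<longleftrightarrow>
      x = - \<eta> *\<^sub>R (a + A *v (- \<eta> *\<^sub>R (b + B *v x)))"
    if "invertible (mat 1 - \<eta>\<^sup>2 *\<^sub>R (A ** B))"
    for A :: "real^'k^'l" and B :: "real^'l^'k" and a b x
  proof -
    have scale: "- \<eta> *\<^sub>R (matrix_inv (mat 1 - \<eta>\<^sup>2 *\<^sub>R (A ** B)) *v (a - \<eta> *\<^sub>R (A *v b))) =
        matrix_inv (mat 1 - \<eta>\<^sup>2 *\<^sub>R (A ** B)) *v (- \<eta> *\<^sub>R (a - \<eta> *\<^sub>R (A *v b)))"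
      by (simp only: matrix_vector_mult_scaleR)
    have "(mat 1 - \<eta>\<^sup>2 *\<^sub>R (A ** B)) *v x = - \<eta> *\<^sub>R (a - \<eta> *\<^sub>R (A *v b)) \<longleftrightarrow>
        x = - \<eta> *\<^sub>R (a + A *v (- \<eta> *\<^sub>R (b + B *v x)))"
    proof -
      have "(mat 1 - \<eta>\<^sup>2 *\<^sub>R (A ** B)) *v x = x - (\<eta> * \<eta>) *\<^sub>R (A *v (B *v x))"
        by (simp add: matrix_vector_mult_diff_rdistrib matrix_vector_mul_assoc power2_eq_square
          flip: scaleR_matrix_vector_assoc)
      moreover have "A *v (- \<eta> *\<^sub>R (b + B *v x)) = - \<eta> *\<^sub>R (A *v b + A *v (B *v x))"
        by (simp only: matrix_vector_mult_scaleR matrix_vector_right_distrib)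
      ultimately show ?thesis
        by (auto simp: algebra_simps)
    qed
    then show ?thesis
      unfolding scale eq_matrix_inv_mult_vector_iff[OF that] .
  qed
  let ?X = "- \<eta> *\<^sub>R (matrix_inv (mat 1 - \<eta>\<^sup>2 *\<^sub>R (A ** B)) *v (a - \<eta> *\<^sub>R (A *v b)))"
  let ?Y = "- \<eta> *\<^sub>R (matrix_inv (mat 1 - \<eta>\<^sup>2 *\<^sub>R (B ** A)) *v (b - \<eta> *\<^sub>R (B *v a)))"
  define F where "F = (\<lambda>y. - \<eta> *\<^sub>R (a + A *v y))"
  define G where "G = (\<lambda>x. - \<eta> *\<^sub>R (b + B *v x))"
  have X: "x = ?X \<longleftrightarrow> x = F (G x)" for x
    unfolding F_def G_def by (rule elim[OF assms(1)])
  have Y: "y = ?Y \<longleftrightarrow> y = G (F y)" for y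
    unfolding F_def G_def by (rule elim[OF assms(2)])
  have "x = F y \<and> y = G x \<longleftrightarrow> x = ?X \<and> y = ?Y"
  proof
    assume "x = F y \<and> y = G x"
    then have "x = F (G x)" and "y = G (F y)" by metis+
    then show "x = ?X \<and> y = ?Y" by (intro conjI iffD2[OF X] iffD2[OF Y])
  next
    assume xy: "x = ?X \<and> y = ?Y"
    then have x: "x = F (G x)" by (intro iffD1[OF X]) (rule conjunct1)
    \<comment> \<open>so \<open>G x\<close> solves the equation whose only solution is the claimed value of \<open>y\<close>\<close>
    then have "G x = G (F (G x))" by (rule arg_cong)
    then have "G x = ?Y" by (rule iffD2[OF Y])
    with xy have "y = G x" by metis
    with x show "x = F y \<and> y = G x" by metis
  qed
  then show ?thesis unfolding F_def G_def .
qed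

section \<open>Uniqueness of the Nash equilibrium\<close>

theorem theorem2p1:
  fixes f g :: "(real^'m) \<times> (real^'n) \<Rightarrow> real"
    and xk :: "real^'m" and yk :: "real^'n" and \<eta> :: real
    and \<mu> :: "(real^'m) measure" and \<nu> :: "(real^'n) measure"
  assumes "twice_differentiable_at f (xk, yk)"
    and "twice_differentiable_at g (xk, yk)"
    and "\<eta> > 0"
    and "invertible (mat 1 - \<eta>\<^sup>2 *\<^sub>R (D2xy f (xk, yk) ** D2yx g (xk, yk)))"
    and "invertible (mat 1 - \<eta>\<^sup>2 *\<^sub>R (D2yx g (xk, yk) ** D2xy f (xk, yk)))"
  shows "nash_equilibrium (objective1 f (xk, yk) \<eta>) (objective2 g (xk, yk) \<eta>) \<mu> \<nu> \<longleftrightarrow>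
      \<mu> = return borel
        (- \<eta> *\<^sub>R (matrix_inv (mat 1 - \<eta>\<^sup>2 *\<^sub>R (D2xy f (xk, yk) ** D2yx g (xk, yk))) *v
          (grad_x f (xk, yk) - \<eta> *\<^sub>R (D2xy f (xk, yk) *v grad_y g (xk, yk))))) \<and>
      \<nu> = return borel
        (- \<eta> *\<^sub>R (matrix_inv (mat 1 - \<eta>\<^sup>2 *\<^sub>R (D2yx g (xk, yk) ** D2xy f (xk, yk))) *v
          (grad_y g (xk, yk) - \<eta> *\<^sub>R (D2yx g (xk, yk) *v grad_x f (xk, yk)))))"
proof -
  let ?A = "D2xy f (xk, yk)" and ?B = "D2yx g (xk, yk)"
  let ?a = "grad_x f (xk, yk)" and ?b = "grad_y g (xk, yk)"
  let ?J1 = "objective1 f (xk, yk) \<eta>" and ?J2 = "objective2 g (xk, yk) \<eta>"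
  define X where "X = - \<eta> *\<^sub>R (matrix_inv (mat 1 - \<eta>\<^sup>2 *\<^sub>R (?A ** ?B)) *v (?a - \<eta> *\<^sub>R (?A *v ?b)))"
  define Y where "Y = - \<eta> *\<^sub>R (matrix_inv (mat 1 - \<eta>\<^sup>2 *\<^sub>R (?B ** ?A)) *v (?b - \<eta> *\<^sub>R (?B *v ?a)))"
  have linear: "bounded_linear ((*v) M)" for M :: "real^'k^'l"
    by simp
  have J2_measurable: "?J2 \<in> borel_measurable borel"
    unfolding objective2_def case_prod_beta
    by (intro borel_measurable_continuous_onI continuous_intros
      linear_continuous_on_compose[OF _ matrix_vector_mul_linear])
  have J2_swap: "(\<lambda>(y, x). ?J2 (x, y)) =
      (\<lambda>(y, x). y \<bullet> ?b + y \<bullet> (?B *v x) + x \<bullet> grad_x g (xk, yk) + 1 / (2 * \<eta>) * (y \<bullet> y))"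
    by (simp add: objective2_def)
  have response1: "(\<forall>\<mu>'. strategy \<mu>' \<longrightarrow>
        ext_expectation (\<mu> \<Otimes>\<^sub>M \<nu>) ?J1 \<le> ext_expectation (\<mu>' \<Otimes>\<^sub>M \<nu>) ?J1) \<longleftrightarrow>
      \<mu> = return borel (- \<eta> *\<^sub>R (?a + ?A *v (\<integral>y. y \<partial>\<nu>)))"
    if "strategy \<mu>" "strategy \<nu>"
    unfolding objective1_def by (rule best_response_iff[OF that linear \<open>\<eta> > 0\<close>])
  have response2: "(\<forall>\<nu>'. strategy \<nu>' \<longrightarrow>
        ext_expectation (\<mu> \<Otimes>\<^sub>M \<nu>) ?J2 \<le> ext_expectation (\<mu> \<Otimes>\<^sub>M \<nu>') ?J2) \<longleftrightarrow>
      \<nu> = return borel (- \<eta> *\<^sub>R (?b + ?B *v (\<integral>x. x \<partial>\<mu>)))"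
    if "strategy \<mu>" "strategy \<nu>"
    using best_response_iff[OF that(2,1) linear \<open>\<eta> > 0\<close>, of ?b ?B "grad_x g (xk, yk)"]
    by (simp add: ext_expectation_swap[OF that(1) _ J2_measurable] that J2_swap cong: imp_cong)
  have mean: "(\<integral>z. z \<partial>return borel v) = v" for v :: "'v::euclidean_space"
    by (rule integral_return) auto
  have fixed_point: "X = - \<eta> *\<^sub>R (?a + ?A *v Y)" "Y = - \<eta> *\<^sub>R (?b + ?B *v X)"
    using best_response_fixed_point_iff[OF assms(4,5), of X ?a Y ?b] unfolding X_def Y_def by blast+
  have "nash_equilibrium ?J1 ?J2 \<mu> \<nu> \<longleftrightarrow> \<mu> = return borel X \<and> \<nu> = return borel Y"
  proof
    assume "nash_equilibrium ?J1 ?J2 \<mu> \<nu>"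
    then have "strategy \<mu>" "strategy \<nu>"
      and \<mu>: "\<mu> = return borel (- \<eta> *\<^sub>R (?a + ?A *v (\<integral>y. y \<partial>\<nu>)))"
      and \<nu>: "\<nu> = return borel (- \<eta> *\<^sub>R (?b + ?B *v (\<integral>x. x \<partial>\<mu>)))"
      using response1 response2 by (auto simp: nash_equilibrium_def)
    have "(\<integral>x. x \<partial>\<mu>) = - \<eta> *\<^sub>R (?a + ?A *v (\<integral>y. y \<partial>\<nu>))" by (subst \<mu>) (rule mean)
    moreover have "(\<integral>y. y \<partial>\<nu>) = - \<eta> *\<^sub>R (?b + ?B *v (\<integral>x. x \<partial>\<mu>))" by (subst \<nu>) (rule mean)
    ultimately have means: "(\<integral>x. x \<partial>\<mu>) = X" "(\<integral>y. y \<partial>\<nu>) = Y"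
      using best_response_fixed_point_iff[OF assms(4,5)] unfolding X_def Y_def by blast+
    have "\<mu> = return borel X" using \<mu> by (simp only: means flip: fixed_point(1))
    moreover have "\<nu> = return borel Y" using \<nu> by (simp only: means flip: fixed_point(2))
    ultimately show "\<mu> = return borel X \<and> \<nu> = return borel Y" ..
  next
    assume XY: "\<mu> = return borel X \<and> \<nu> = return borel Y"
    then have strategies: "strategy \<mu>" "strategy \<nu>" by (simp_all add: strategy_return)
    have means: "(\<integral>x. x \<partial>\<mu>) = X" "(\<integral>y. y \<partial>\<nu>) = Y" using XY mean by auto
    from XY show "nash_equilibrium ?J1 ?J2 \<mu> \<nu>"
      unfolding nash_equilibrium_def response1[OF strategies] response2[OF strategies] means
        fixed_point[symmetric]
      by (intro conjI strategies) simp_all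
  qed
  then show ?thesis unfolding X_def Y_def .
qed

end
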